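(* Let $(L,\leq)$ be a weakly atomic completely semidistributive (complete) lattice. Suppose $L$ is extremal, so that the labelling quiver $Q_L$ has no oriented cycles and $(\mathrm{JI}^c(L),\preceq)$ is a poset, where $x\preceq y$ if there is an oriented path (possibly of length $0$) from $y$ to $x$ in $Q_L$. Then there is a bijection between linear extensions of $\preceq$ and extremal chains in $L$: a linear extension $\mathcal L$ of $\preceq$, with set of downsets $D(\mathcal L)$, is sent to the extremal chain $\{\bigvee D\mid D\in D(\mathcal L)\}$.
   Context: Lattices are complete and possibly infinite; $x\lessdot y$ denotes a cover relation. $L$ is weakly atomic if for all $x<y$ there are $u,v$ with $x\leq u\lessdot v\leq y$. $L$ is completely semidistributive if for all $x\in L$, $S\subseteq L$: if $x\vee y=x\vee z$ for all $y,z\in S$ then $x\vee\bigwedge S=x\vee y$ for all $y\in S$; and dually, if $x\wedge y=x\wedge z$ for all $y,z\in S$ then $x\wedge\bigvee S=x\wedge y$ for all $y\in S$. $\mathrm{JI}^c(L)$ is the set of completely join-irreducible elements: those $x\neq\bigvee\emptyset$ with $x\neq\bigvee S$ for every $S\subseteq\{y\mid y<x\}$; then $x_*:=\bigvee\{y\mid y<x\}$ is the unique lower cover of $x$. $\mathrm{MI}^c(L)$ (completely meet-irreducible elements) is defined dually. For $L$ as in the claim there is a bijection $\kappa:\mathrm{JI}^c(L)\to\mathrm{MI}^c(L)$, $\kappa(j)=\max\{y\in L\mid j\wedge y=j_*\}$ (the maximum exists; known fact). A maximal (with respect to inclusion) chain $\mathcal X$ in $L$ is extremal if for each $j\in\mathrm{JI}^c(L)$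 there are $x<y$ in $\mathcal X$ with $x\vee j=y$ and $y\wedge\kappa(j)=x$. $L$ is extremal if it has an extremal maximal chain. The labelling quiver $Q_L$ is the directed graph with vertex set $\mathrm{JI}^c(L)$ and, for $i,j\in\mathrm{JI}^c(L)$, an arrow $i\to j$ precisely when $i\neq j$ and $i\not\leq\kappa(j)$. A linear extension of $\preceq$ is a total order on $\mathrm{JI}^c(L)$ extending $\preceq$. A downset of $\mathcal L$ is a subset $D\subseteq\mathrm{JI}^c(L)$ such that $y\in D$ and $x\leq_{\mathcal L}y$ imply $x\in D$ (the empty set and the whole set included). *)

theory Defs
  imports Main
begin

text \<open>The lattice is the whole of a type of class \<open>complete_lattice\<close>; this class
  does not require \<open>bot\<close> and \<open>top\<close> to be distinct.\<close>

definition cover :: "'a::order \<Rightarrow> 'a \<Rightarrow> bool"  (infix "\<lessdot>" 50)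
  where "x \<lessdot> y \<longleftrightarrow> x < y \<and> (\<nexists>z. x < z \<and> z < y)"

definition weakly_atomic :: "'a::complete_lattice itself \<Rightarrow> bool"
  where "weakly_atomic _ \<longleftrightarrow>
    (\<forall>x y :: 'a. x < y \<longrightarrow> (\<exists>u v. x \<le> u \<and> u \<lessdot> v \<and> v \<le> y))"

definition completely_semidistributive :: "'a::complete_lattice itself \<Rightarrow> bool"
  where "completely_semidistributive _ \<longleftrightarrow>
    (\<forall>(x :: 'a) S. (\<forall>y\<in>S. \<forall>z\<in>S. sup x y = sup x z) \<longrightarrow> (\<forall>y\<in>S. sup x (Inf S) = sup x y)) \<and>
    (\<forall>(x :: 'a) S. (\<forall>y\<in>S. \<forall>z\<in>S. inf x y = inf x z) \<longrightarrow> (\<forall>y\<in>S. inf x (Sup S) = inf x y))"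

definition JIc :: "'a::complete_lattice set"
  where "JIc = {x. x \<noteq> Sup {} \<and> (\<forall>S \<subseteq> {y. y < x}. x \<noteq> Sup S)}"

definition lower_star :: "'a::complete_lattice \<Rightarrow> 'a"
  where "lower_star x = Sup {y. y < x}"

text \<open>In a completely semidistributive lattice the set below has a maximum whenever
  \<open>j \<in> JIc\<close>; \<open>kappa\<close> is only meaningful under these hypotheses.\<close>

definition kappa :: "'a::complete_lattice \<Rightarrow> 'a"
  where "kappa j = (GREATEST y. inf j y = lower_star j)"

definition extremal_chain :: "'a::complete_lattice set \<Rightarrow> bool"
  where "extremal_chain X \<longleftrightarrow>
    pred_on.maxchain UNIV (\<le>) X \<and>
    (\<forall>j\<in>JIc. \<exists>x\<in>X. \<exists>y\<in>X. x < y \<and> sup x j = y \<and> inf y (kappa j) = x)"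

definition extremal_lattice :: "'a::complete_lattice itself \<Rightarrow> bool"
  where "extremal_lattice _ \<longleftrightarrow> (\<exists>X :: 'a set. extremal_chain X)"

definition labelling_quiver :: "'a::complete_lattice rel"
  where "labelling_quiver = {(i, j). i \<in> JIc \<and> j \<in> JIc \<and> i \<noteq> j \<and> \<not> i \<le> kappa j}"

text \<open>\<open>(x, y) \<in> quiver_order\<close> means \<open>x \<preceq> y\<close>: paths run from the larger to the
  smaller element.\<close>

definition quiver_order :: "'a::complete_lattice rel"
  where "quiver_order = {(x, y). x \<in> JIc \<and> y \<in> JIc \<and> (y, x) \<in> labelling_quiver\<^sup>*}"

definition linear_extension :: "'a set \<Rightarrow> 'a rel \<Rightarrow> 'a rel \<Rightarrow> bool"
  where "linear_extension A p r \<longleftrightarrow> linear_order_on A r \<and> p \<subseteq> r"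

definition downsets :: "'a set \<Rightarrow> 'a rel \<Rightarrow> 'a set set"
  where "downsets A r = {D. D \<subseteq> A \<and> (\<forall>x y. y \<in> D \<and> (x, y) \<in> r \<longrightarrow> x \<in> D)}"

end

theory Submission
  imports Defs
begin

text \<open>
  Write \<open>j\<close> for a completely join-irreducible element.  Everything rests on one dichotomy:
  each element \<open>z\<close> of an extremal chain satisfies, for every \<open>j\<close>, exactly one of \<open>j \<le> z\<close> and
  \<open>z \<le> kappa j\<close> (\<open>extremal_chain_split\<close>).  So \<open>z\<close> cuts the set of join-irreducibles in two,
  and if \<open>i\<close> lies below \<open>z\<close> while \<open>j\<close> does not, then \<open>i \<le> z \<le> kappa j\<close>: no arrow of the
  labelling quiver leads from \<open>i\<close> to \<open>j\<close>.  Along the chain the join-irreducibles are thus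
  collected one after the other, and the order in which they appear, \<open>chain_order\<close>, extends the
  quiver order.  It is antisymmetric because two join-irreducibles that appear in the same
  step \<open>x < y\<close> satisfy \<open>x \<squnion> i = y = x \<squnion> j\<close>, whence \<open>x \<squnion> (i \<sqinter> j) = y\<close> by semidistributivity,
  while any element strictly below \<open>i\<close> is already below \<open>x\<close>.  Acyclicity of the quiver
  follows.

  In the other direction, let \<open>D\<close> be a downset of a linear extension.  An element \<open>j\<close> outside
  \<open>D\<close> receives no arrow from \<open>D\<close>, so \<open>\<Squnion>D \<le> kappa j\<close>: the dichotomy holds again, now
  with \<open>D\<close> recoverable from \<open>\<Squnion>D\<close> as the set of join-irreducibles below it.

  The two passages are mutually inverse because every element is the join of the
  join-irreducibles below it (\<open>Sup_JIc_below\<close>).  This is where weak atomicity enters: every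
  proper interval contains a cover \<open>u \<lessdot> v\<close>, and the least \<open>z\<close> with \<open>u \<squnion> z = v\<close>, which exists
  by complete semidistributivity, is join-irreducible.
\<close>

section \<open>Join-irreducible elements in completely semidistributive lattices\<close>

lemma Inf_sup_const:
  fixes x :: "'a::complete_lattice"
  assumes "completely_semidistributive TYPE('a)"
    and "\<And>z. z \<in> S \<Longrightarrow> sup x z = c" and "S \<noteq> {}"
  shows "sup x (Inf S) = c"
  using assms unfolding completely_semidistributive_def by (metis ex_in_conv)

lemma Sup_inf_const:
  fixes x :: "'a::complete_lattice"
  assumes "completely_semidistributive TYPE('a)"
    and "\<And>z. z \<in> S \<Longrightarrow> inf x z = c" and "S \<noteq> {}"
  shows "inf x (Sup S) = c"
  using assms unfolding completely_semidistributive_def by (metis ex_in_conv)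

lemma lower_star_less:
  fixes j :: "'a::complete_lattice"
  assumes "j \<in> JIc"
  shows "lower_star j < j"
proof -
  have "lower_star j \<le> j"
    unfolding lower_star_def by (rule Sup_least) auto
  moreover have "lower_star j \<noteq> j"
    using assms unfolding JIc_def lower_star_def by auto
  ultimately show ?thesis by simp
qed

lemma le_lower_star: "z < j \<Longrightarrow> z \<le> lower_star j"
  for j :: "'a::complete_lattice"
  unfolding lower_star_def by (rule Sup_upper) simp

lemma JIcI:
  fixes j m :: "'a::complete_lattice"
  assumes "\<not> j \<le> m" and "\<And>z. z < j \<Longrightarrow> z \<le> m"
  shows "j \<in> JIc"
  using assms unfolding JIc_def by (auto intro: Sup_least)

text \<open>The set whose greatest element defines \<open>kappa j\<close> contains its own join, by complete
  semidistributivity.\<close>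

lemma inf_kappa:
  fixes j :: "'a::complete_lattice"
  assumes csd: "completely_semidistributive TYPE('a)" and j: "j \<in> JIc"
  shows "inf j (kappa j) = lower_star j"
    and "inf j y = lower_star j \<Longrightarrow> y \<le> kappa j"
proof -
  let ?T = "{y. inf j y = lower_star j}"
  have "lower_star j \<in> ?T"
    using lower_star_less[OF j] by (simp add: inf_absorb2)
  then have max: "inf j (Sup ?T) = lower_star j"
    by (intro Sup_inf_const[OF csd]) auto
  have eq: "kappa j = Sup ?T"
    unfolding kappa_def by (rule Greatest_equality) (auto simp: max intro: Sup_upper)
  show "inf j (kappa j) = lower_star j"
    by (simp add: eq max)
  show "inf j y = lower_star j \<Longrightarrow> y \<le> kappa j"
    by (auto simp: eq intro: Sup_upper)
qed

lemma not_le_kappa: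
  fixes j :: "'a::complete_lattice"
  assumes "completely_semidistributive TYPE('a)" and "j \<in> JIc"
  shows "\<not> j \<le> kappa j"
  using inf_kappa(1)[OF assms] lower_star_less[OF assms(2)] by (auto simp: inf_absorb1)

text \<open>An element that is not above \<open>j\<close> meets \<open>j\<close> in something below its lower cover, so
  containing that lower cover is enough to make the meet equal to it.\<close>

lemma le_or_le_kappa:
  fixes j :: "'a::complete_lattice"
  assumes csd: "completely_semidistributive TYPE('a)" and j: "j \<in> JIc"
    and z: "lower_star j \<le> z"
  shows "j \<le> z \<or> z \<le> kappa j"
proof (rule disjCI)
  assume "\<not> z \<le> kappa j"
  then have "inf j z \<noteq> lower_star j"
    using inf_kappa(2)[OF csd j] by blast
  moreover have "lower_star j \<le> inf j z"
    using z lower_star_less[OF j] by simp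
  ultimately have "\<not> inf j z < j"
    using le_lower_star antisym by metis
  then show "j \<le> z"
    by (metis inf_le1 inf_le2 order_le_less)
qed

text \<open>The least \<open>z\<close> with \<open>u \<squnion> z = v\<close> is the label of the cover.  Anything strictly below the
  label no longer reaches \<open>v\<close>, so it stays below \<open>u\<close>.\<close>

lemma cover_label:
  fixes u v :: "'a::complete_lattice"
  assumes csd: "completely_semidistributive TYPE('a)" and uv: "u \<lessdot> v"
  obtains j where "j \<in> JIc" and "sup u j = v"
proof
  let ?S = "{z. sup u z = v}"
  let ?j = "Inf ?S"
  have "v \<in> ?S"
    using uv by (simp add: cover_def sup_absorb2 less_imp_le)
  then show sup: "sup u ?j = v"
    by (intro Inf_sup_const[OF csd]) auto
  show "?j \<in> JIc"
  proof (rule JIcI)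
    show "\<not> ?j \<le> u"
      using sup uv by (auto simp: cover_def sup_absorb1)
    fix z assume z: "z < ?j"
    then have "sup u z \<noteq> v"
      using Inf_lower[of z ?S] by auto
    moreover have "sup u z \<le> v"
      using z sup by (metis less_imp_le order_refl sup.mono)
    ultimately have "\<not> u < sup u z"
      using uv unfolding cover_def by (meson order_le_less)
    then show "z \<le> u"
      by (metis order_le_less sup_ge1 sup_ge2)
  qed
qed

lemma Sup_JIc_below:
  fixes x :: "'a::complete_lattice"
  assumes wa: "weakly_atomic TYPE('a)" and csd: "completely_semidistributive TYPE('a)"
  shows "Sup {j \<in> JIc. j \<le> x} = x"
proof (rule ccontr)
  let ?s = "Sup {j \<in> JIc. j \<le> x}"
  assume "?s \<noteq> x"
  moreover have "?s \<le> x"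
    by (rule Sup_least) simp
  ultimately have "?s < x" by simp
  then obtain u v where su: "?s \<le> u" and uv: "u \<lessdot> v" and vx: "v \<le> x"
    using wa[unfolded weakly_atomic_def, rule_format, of ?s x] by blast
  obtain j where j: "j \<in> JIc" "sup u j = v"
    using cover_label[OF csd uv] .
  have "j \<le> ?s"
    using j vx by (intro Sup_upper) auto
  then have "sup u j = u"
    using su by (simp add: sup_absorb1)
  with j uv show False by (simp add: cover_def)
qed

section \<open>The order in which a chain collects the join-irreducibles\<close>

lemma maxchain_iff:
  "pred_on.maxchain UNIV (\<le>) (X :: 'a::order set) \<longleftrightarrow>
    (\<forall>x\<in>X. \<forall>y\<in>X. x \<le> y \<or> y \<le> x) \<and> (\<forall>w. (\<forall>x\<in>X. x \<le> w \<or> w \<le> x) \<longrightarrow> w \<in> X)"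
  (is "?M \<longleftrightarrow> ?C X \<and> ?W")
proof -
  have chain: "pred_on.chain UNIV (\<le>) Y \<longleftrightarrow> ?C Y" for Y :: "'a set"
    unfolding pred_on.chain_def by auto
  show ?thesis
  proof
    assume M: ?M
    then have C: "?C X" and max: "\<not> (?C Y \<and> X \<subset> Y)" for Y
      unfolding pred_on.maxchain_def chain by simp_all
    have "w \<in> X" if "\<forall>x\<in>X. x \<le> w \<or> w \<le> x" for w
    proof -
      have "?C (insert w X)"
        using C that by blast
      then show ?thesis using max[of "insert w X"] by blast
    qed
    with C show "?C X \<and> ?W" by blast
  next
    assume *: "?C X \<and> ?W"
    have False if Y: "?C Y" "X \<subset> Y" for Y
    proof -
      obtain w where "w \<in> Y" "w \<notin> X" using Y(2) by blast
      then show False using * Y by blast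
    qed
    with * show ?M
      unfolding pred_on.maxchain_def chain by simp blast
  qed
qed

definition chain_order :: "'a::complete_lattice set \<Rightarrow> 'a rel"
  where "chain_order X = {(i, j). i \<in> JIc \<and> j \<in> JIc \<and> (\<forall>z\<in>X. j \<le> z \<longrightarrow> i \<le> z)}"

text \<open>The step \<open>x < y\<close> of the chain at which \<open>j\<close> is collected.  By the last two properties it
  divides the chain into the elements that are not above \<open>j\<close> and those that are.  Indeed, an
  element of the chain between \<open>x\<close> and \<open>y\<close> contains the lower cover of \<open>j\<close>, so it is either above
  \<open>x \<squnion> j = y\<close> or below \<open>y \<sqinter> kappa j = x\<close>.\<close>

lemma extremal_chain_step:
  fixes X :: "'a::complete_lattice set"
  assumes csd: "completely_semidistributive TYPE('a)"
    and X: "extremal_chain X" and j: "j \<in> JIc"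
  obtains x y where "x \<in> X" "y \<in> X" "x < y" "sup x j = y" "inf y (kappa j) = x"
    "lower_star j \<le> x"
    "\<And>z. z \<in> X \<Longrightarrow> \<not> j \<le> z \<Longrightarrow> z \<le> x" "\<And>z. z \<in> X \<Longrightarrow> j \<le> z \<Longrightarrow> y \<le> z"
proof -
  obtain x y where xy: "x \<in> X" "y \<in> X" "x < y" "sup x j = y" "inf y (kappa j) = x"
    using X j unfolding extremal_chain_def by metis
  have lin: "\<forall>x\<in>X. \<forall>y\<in>X. x \<le> y \<or> y \<le> x"
    using X unfolding extremal_chain_def maxchain_iff by blast
  have jy: "j \<le> y" and xk: "x \<le> kappa j"
    using xy sup_ge2 inf_le2 by metis+
  have star: "lower_star j \<le> x"
  proof -
    have "lower_star j \<le> y"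
      using jy lower_star_less[OF j] by simp
    moreover have "lower_star j \<le> kappa j"
      using inf_kappa(1)[OF csd j] inf_le2 by metis
    ultimately show ?thesis using xy(5) by (metis inf_greatest)
  qed
  have up: "y \<le> z" if "z \<in> X" "j \<le> z" for z
  proof -
    have "\<not> z \<le> x"
      using that xk not_le_kappa[OF csd j] by (meson order_trans)
    then have "x \<le> z" using lin that xy by blast
    then show ?thesis using that xy(4) by auto
  qed
  have down: "z \<le> x" if "z \<in> X" "\<not> j \<le> z" for z
  proof (rule ccontr)
    assume "\<not> z \<le> x"
    then have "x \<le> z" using lin that xy by blast
    then have "z \<le> kappa j"
      using le_or_le_kappa[OF csd j] star that by (meson order_trans)
    moreover have "z \<le> y"
      using lin that xy jy by (meson order_trans)
    ultimately show False
      using xy(5) \<open>\<not> z \<le> x\<close> by (metis inf_greatest)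
  qed
  show thesis by (rule that[OF xy star down up])
qed

lemma extremal_chain_split:
  fixes X :: "'a::complete_lattice set"
  assumes csd: "completely_semidistributive TYPE('a)"
    and X: "extremal_chain X" and j: "j \<in> JIc" and z: "z \<in> X"
  shows "j \<le> z \<or> z \<le> kappa j"
  using extremal_chain_step[OF csd X j] z by (metis inf_le2 order_trans)

text \<open>Two join-irreducibles that the chain does not separate belong to the same step, and that
  step has only one label.\<close>

lemma antisym_chain_order:
  fixes X :: "'a::complete_lattice set"
  assumes csd: "completely_semidistributive TYPE('a)" and X: "extremal_chain X"
  shows "antisym (chain_order X)"
proof (rule antisymI)
  fix i j assume "(i, j) \<in> chain_order X" "(j, i) \<in> chain_order X"
  then have i: "i \<in> JIc" and j: "j \<in> JIc" and same: "\<And>z. z \<in> X \<Longrightarrow> i \<le> z \<longleftrightarrow> j \<le> z"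
    unfolding chain_order_def by blast+
  obtain x y where xy: "x \<in> X" "y \<in> X" "x < y" "sup x i = y" "lower_star i \<le> x"
    "\<And>z. z \<in> X \<Longrightarrow> \<not> i \<le> z \<Longrightarrow> z \<le> x" "\<And>z. z \<in> X \<Longrightarrow> i \<le> z \<Longrightarrow> y \<le> z"
    using extremal_chain_step[OF csd X i] by metis
  obtain x' y' where xy': "x' \<in> X" "y' \<in> X" "x' < y'" "sup x' j = y'" "lower_star j \<le> x'"
    "\<And>z. z \<in> X \<Longrightarrow> \<not> j \<le> z \<Longrightarrow> z \<le> x'" "\<And>z. z \<in> X \<Longrightarrow> j \<le> z \<Longrightarrow> y' \<le> z"
    using extremal_chain_step[OF csd X j] by metis
  have ni: "\<not> i \<le> x" and nj: "\<not> j \<le> x'"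
    using xy(3,4) xy'(3,4) by (auto simp: sup_absorb1)
  have "i \<le> y" "j \<le> y'"
    using xy(4) xy'(4) by auto
  then have "y = y'"
    using xy(2,7) xy'(2,7) same by (simp add: antisym)
  have "x = x'"
    using xy(1,6) xy'(1,6) same ni nj by (simp add: antisym)
  have "sup x (Inf {i, j}) = y"
    using xy(4) xy'(4) \<open>x = x'\<close> \<open>y = y'\<close> by (intro Inf_sup_const[OF csd]) auto
  then have meet: "\<not> inf i j \<le> x"
    using xy(3) by (auto simp: sup_absorb1)
  have "inf i j = i"
    using meet xy(5) le_lower_star[of "inf i j" i] by (metis inf_le1 order_trans order_less_le)
  moreover have "inf i j = j"
    using meet xy'(5) \<open>x = x'\<close> le_lower_star[of "inf i j" j]
    by (metis inf_le2 order_trans order_less_le)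
  ultimately show "i = j" by simp
qed

lemma linear_order_chain_order:
  fixes X :: "'a::complete_lattice set"
  assumes csd: "completely_semidistributive TYPE('a)" and X: "extremal_chain X"
  shows "linear_order_on JIc (chain_order X)"
proof -
  have lin: "\<forall>x\<in>X. \<forall>y\<in>X. x \<le> y \<or> y \<le> x"
    using X unfolding extremal_chain_def maxchain_iff by blast
  have "(\<forall>z\<in>X. j \<le> z \<longrightarrow> i \<le> z) \<or> (\<forall>z\<in>X. i \<le> z \<longrightarrow> j \<le> z)" for i j
    using lin by (meson order_trans)
  then have "(i, j) \<in> chain_order X \<or> (j, i) \<in> chain_order X" if "i \<in> JIc" "j \<in> JIc" for i j
    using that unfolding chain_order_def by simp
  then have "total_on JIc (chain_order X)"
    unfolding total_on_def by blast
  moreover have "chain_order X \<subseteq> JIc \<times> JIc" "refl_on JIc (chain_order X)"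
    "trans (chain_order X)"
    unfolding chain_order_def refl_on_def trans_def by auto
  ultimately show ?thesis
    using antisym_chain_order[OF csd X]
    unfolding linear_order_on_def partial_order_on_def preorder_on_def by blast
qed

text \<open>If \<open>i \<rightarrow> j\<close> is an arrow, then an element of the chain above \<open>i\<close> is not below \<open>kappa j\<close>, so it
  is above \<open>j\<close>: arrows point to elements that appear earlier.\<close>

lemma labelling_quiver_subset_chain_order:
  fixes X :: "'a::complete_lattice set"
  assumes csd: "completely_semidistributive TYPE('a)" and X: "extremal_chain X"
  shows "labelling_quiver \<subseteq> (chain_order X)\<inverse> - Id"
proof (rule subrelI)
  fix i j :: 'a assume ij: "(i, j) \<in> labelling_quiver"
  have "j \<le> z" if "z \<in> X" "i \<le> z" for z
    using extremal_chain_split[OF csd X _ that(1), of j] order_trans[OF that(2)] ij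
    unfolding labelling_quiver_def by blast
  with ij show "(i, j) \<in> (chain_order X)\<inverse> - Id"
    unfolding labelling_quiver_def chain_order_def by simp
qed

lemma acyclic_labelling_quiver:
  fixes X :: "'a::complete_lattice set"
  assumes csd: "completely_semidistributive TYPE('a)" and X: "extremal_chain X"
  shows "acyclic (labelling_quiver :: 'a rel)"
proof -
  have "partial_order_on JIc (chain_order X)"
    using linear_order_chain_order[OF csd X] unfolding linear_order_on_def by blast
  then have "trans (chain_order X - Id)" and "irrefl (chain_order X - Id)"
    unfolding partial_order_on_def preorder_on_def by (auto intro: trans_diff_Id irrefl_diff_Id)
  then have "acyclic (chain_order X - Id)"
    by (simp add: acyclic_irrefl)
  then have "acyclic ((chain_order X - Id)\<inverse>)"
    by simp
  then show ?thesis
    by (rule acyclic_subset) (use labelling_quiver_subset_chain_order[OF csd X] in auto)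
qed

lemma linear_extension_chain_order:
  fixes X :: "'a::complete_lattice set"
  assumes csd: "completely_semidistributive TYPE('a)" and X: "extremal_chain X"
  shows "linear_extension JIc quiver_order (chain_order X)"
proof -
  note lin = linear_order_chain_order[OF csd X]
  have "(x, y) \<in> chain_order X" if "(y, x) \<in> labelling_quiver\<^sup>*" "y \<in> JIc" for x y
    using that
  proof (induction rule: rtrancl_induct)
    case base
    then show ?case by (simp add: chain_order_def)
  next
    case (step u v)
    then have "(v, u) \<in> chain_order X" "(u, y) \<in> chain_order X"
      using labelling_quiver_subset_chain_order[OF csd X] by auto
    then show ?case by (auto simp: chain_order_def)
  qed
  with lin show ?thesis
    unfolding linear_extension_def quiver_order_def by auto
qed

lemma partial_order_quiver_order:
  assumes ac: "acyclic (labelling_quiver :: 'a::complete_lattice rel)"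
  shows "partial_order_on JIc (quiver_order :: 'a rel)"
proof -
  have "antisym ((labelling_quiver :: 'a rel)\<^sup>*)"
    using ac by (rule acyclic_impl_antisym_rtrancl)
  then have "antisym (quiver_order :: 'a rel)"
    unfolding quiver_order_def antisym_def by auto
  moreover have "trans (quiver_order :: 'a rel)"
    unfolding quiver_order_def by (rule transI) (auto intro: rtrancl_trans)
  moreover have "quiver_order \<subseteq> JIc \<times> (JIc :: 'a set)" "refl_on JIc (quiver_order :: 'a rel)"
    unfolding quiver_order_def refl_on_def by auto
  ultimately show ?thesis
    unfolding partial_order_on_def preorder_on_def by blast
qed

section \<open>The chain of joins of downsets\<close>

definition downset_chain :: "'a::complete_lattice rel \<Rightarrow> 'a set"
  where "downset_chain r = {Sup D | D. D \<in> downsets JIc r}"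

lemma downset_chain_chain_order:
  fixes X :: "'a::complete_lattice set"
  assumes wa: "weakly_atomic TYPE('a)" and csd: "completely_semidistributive TYPE('a)"
    and X: "extremal_chain X"
  shows "downset_chain (chain_order X) = X"
proof (intro equalityI subsetI)
  have lin: "\<forall>x\<in>X. \<forall>y\<in>X. x \<le> y \<or> y \<le> x"
    and max: "\<And>w. \<forall>x\<in>X. x \<le> w \<or> w \<le> x \<Longrightarrow> w \<in> X"
    using X unfolding extremal_chain_def maxchain_iff by blast+
  {
    fix z assume "z \<in> X"
    then have "{j \<in> JIc. j \<le> z} \<in> downsets JIc (chain_order X)"
      unfolding downsets_def chain_order_def by auto
    then show "z \<in> downset_chain (chain_order X)"
      using Sup_JIc_below[OF wa csd, of z] unfolding downset_chain_def by force
  next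
    fix w assume "w \<in> downset_chain (chain_order X)"
    then obtain D where D: "D \<in> downsets JIc (chain_order X)" and w: "w = Sup D"
      unfolding downset_chain_def by blast
    have "z \<le> w \<or> w \<le> z" if z: "z \<in> X" for z
    proof (cases "\<forall>j\<in>D. j \<le> z")
      case True
      then show ?thesis using w by (simp add: Sup_least)
    next
      case False
      then obtain j where j: "j \<in> D" "\<not> j \<le> z" by blast
      \<comment> \<open>The join-irreducibles below \<open>z\<close> appear before \<open>j\<close>, so all of them belong to \<open>D\<close>.\<close>
      have "i \<in> D" if i: "i \<in> JIc" "i \<le> z" for i
      proof -
        have "z \<le> z'" if "z' \<in> X" "j \<le> z'" for z'
          using lin that z j(2) by (meson order_trans)
        moreover have "j \<in> JIc"
          using D j(1) unfolding downsets_def by blast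
        ultimately have "(i, j) \<in> chain_order X"
          using i order_trans[OF i(2)] unfolding chain_order_def by simp
        then show ?thesis
          using D j(1) unfolding downsets_def by blast
      qed
      then have "Sup {i \<in> JIc. i \<le> z} \<le> w"
        unfolding w by (intro Sup_subset_mono) auto
      then show ?thesis using Sup_JIc_below[OF wa csd, of z] by simp
    qed
    then show "w \<in> X" by (intro max) blast
  }
qed

text \<open>An arrow \<open>i \<rightarrow> j\<close> forces \<open>j\<close> to precede \<open>i\<close> in every linear extension, so a downset that
  contains \<open>i\<close> but not \<open>j\<close> must have \<open>i \<le> kappa j\<close>.\<close>

lemma Sup_downset_le_kappa:
  fixes r :: "'a::complete_lattice rel"
  assumes r: "linear_extension JIc quiver_order r"
    and D: "D \<in> downsets JIc r" and j: "j \<in> JIc" "j \<notin> D"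
  shows "Sup D \<le> kappa j"
proof (rule Sup_least, rule ccontr)
  fix i assume i: "i \<in> D" "\<not> i \<le> kappa j"
  then have "(i, j) \<in> labelling_quiver"
    using D j unfolding labelling_quiver_def downsets_def by auto
  then have "(j, i) \<in> quiver_order"
    unfolding quiver_order_def labelling_quiver_def by auto
  then show False
    using r D j i unfolding linear_extension_def downsets_def by blast
qed

lemma le_Sup_downset_iff:
  fixes r :: "'a::complete_lattice rel"
  assumes csd: "completely_semidistributive TYPE('a)"
    and r: "linear_extension JIc quiver_order r"
    and D: "D \<in> downsets JIc r" and j: "j \<in> JIc"
  shows "j \<le> Sup D \<longleftrightarrow> j \<in> D"
proof
  assume "j \<le> Sup D"
  then show "j \<in> D"
    using Sup_downset_le_kappa[OF r D j] not_le_kappa[OF csd j] order_trans by blast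
qed (rule Sup_upper)

lemma principal_downsets:
  assumes "linear_order_on A r" and "a \<in> A"
  shows "{b. (b, a) \<in> r} \<in> downsets A r" and "{b. (b, a) \<in> r \<and> b \<noteq> a} \<in> downsets A r"
    and "a \<in> {b. (b, a) \<in> r}"
proof -
  have "r \<subseteq> A \<times> A" "refl_on A r" "trans r" "antisym r"
    using assms(1) unfolding linear_order_on_def partial_order_on_def preorder_on_def by blast+
  then show "{b. (b, a) \<in> r} \<in> downsets A r" "{b. (b, a) \<in> r \<and> b \<noteq> a} \<in> downsets A r"
    "a \<in> {b. (b, a) \<in> r}"
    using assms(2) unfolding downsets_def
    by (auto dest: refl_onD transD antisymD)
qed

lemma downsets_chain:
  assumes r: "linear_order_on A r" and D: "D \<in> downsets A r" and E: "E \<in> downsets A r"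
  shows "D \<subseteq> E \<or> E \<subseteq> D"
proof -
  have "total_on A r" "refl_on A r"
    using r unfolding linear_order_on_def partial_order_on_def preorder_on_def by blast+
  then have "(a, b) \<in> r \<or> (b, a) \<in> r" if "a \<in> A" "b \<in> A" for a b
    using that unfolding total_on_def refl_on_def by metis
  then show ?thesis using D E unfolding downsets_def by blast
qed

lemma chain_order_downset_chain:
  fixes r :: "'a::complete_lattice rel"
  assumes csd: "completely_semidistributive TYPE('a)"
    and r: "linear_extension JIc quiver_order r"
  shows "chain_order (downset_chain r) = r"
proof -
  have lin: "linear_order_on JIc r"
    using r unfolding linear_extension_def by blast
  then have sub: "r \<subseteq> JIc \<times> JIc"
    unfolding linear_order_on_def partial_order_on_def preorder_on_def by blast
  have "(i, j) \<in> chain_order (downset_chain r) \<longleftrightarrow> (i, j) \<in> r"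
    if ij: "i \<in> JIc" "j \<in> JIc" for i j
  proof -
    have "(i, j) \<in> chain_order (downset_chain r) \<longleftrightarrow>
        (\<forall>D\<in>downsets JIc r. j \<le> Sup D \<longrightarrow> i \<le> Sup D)"
      using ij unfolding chain_order_def downset_chain_def by auto
    also have "\<dots> \<longleftrightarrow> (\<forall>D\<in>downsets JIc r. j \<in> D \<longrightarrow> i \<in> D)"
      using le_Sup_downset_iff[OF csd r _ ij(1)] le_Sup_downset_iff[OF csd r _ ij(2)] by simp
    also have "\<dots> \<longleftrightarrow> (i, j) \<in> r"
    proof
      assume "\<forall>D\<in>downsets JIc r. j \<in> D \<longrightarrow> i \<in> D"
      from bspec[OF this principal_downsets(1)[OF lin ij(2)]] show "(i, j) \<in> r"
        using principal_downsets(3)[OF lin ij(2)] by simp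
    next
      assume "(i, j) \<in> r"
      then show "\<forall>D\<in>downsets JIc r. j \<in> D \<longrightarrow> i \<in> D"
        unfolding downsets_def by blast
    qed
    finally show ?thesis .
  qed
  with sub show ?thesis
    unfolding chain_order_def by blast
qed

text \<open>Let \<open>w\<close> be comparable with all joins of downsets.  If \<open>j \<le> w\<close> and \<open>i\<close> comes before \<open>j\<close>, the
  join of the downset generated by \<open>i\<close> is not above \<open>w\<close>, since it is not above \<open>j\<close>; hence it is
  below \<open>w\<close>, and so is \<open>i\<close>.  The join-irreducibles below \<open>w\<close> thus form a downset, which gives
  maximality.  The step attached to \<open>j\<close> consists of the joins of the two downsets generated by
  \<open>j\<close>, without and with \<open>j\<close> itself.\<close>

lemma extremal_chain_downset_chain:
  fixes r :: "'a::complete_lattice rel"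
  assumes wa: "weakly_atomic TYPE('a)" and csd: "completely_semidistributive TYPE('a)"
    and r: "linear_extension JIc quiver_order r"
  shows "extremal_chain (downset_chain r)"
  unfolding extremal_chain_def maxchain_iff
proof (intro conjI ballI allI impI)
  have lin: "linear_order_on JIc r"
    using r unfolding linear_extension_def by blast
  then have sub: "r \<subseteq> JIc \<times> JIc" and anti: "antisym r"
    unfolding linear_order_on_def partial_order_on_def preorder_on_def by blast+
  note mem = le_Sup_downset_iff[OF csd r]
  note spatial = Sup_JIc_below[OF wa csd]
  {
    fix x y assume "x \<in> downset_chain r" "y \<in> downset_chain r"
    then obtain D E where "D \<in> downsets JIc r" "E \<in> downsets JIc r" "x = Sup D" "y = Sup E"
      unfolding downset_chain_def by blast
    then show "x \<le> y \<or> y \<le> x"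
      using downsets_chain[OF lin, of D E] Sup_subset_mono[of D E] Sup_subset_mono[of E D]
      by blast
  next
    fix w assume comp: "\<forall>x\<in>downset_chain r. x \<le> w \<or> w \<le> x"
    have "i \<le> w" if ij: "(i, j) \<in> r" and jw: "j \<le> w" for i j
    proof (cases "i = j")
      case False
      have i: "i \<in> JIc" and j: "j \<in> JIc" using ij sub by auto
      let ?D = "{k. (k, i) \<in> r}"
      note D = principal_downsets(1)[OF lin i]
      have "j \<notin> ?D"
        using ij anti False unfolding antisym_def by blast
      then have "\<not> w \<le> Sup ?D"
        using mem[OF D j] order_trans[OF jw] by blast
      moreover have "Sup ?D \<in> downset_chain r"
        using D unfolding downset_chain_def by blast
      ultimately have "Sup ?D \<le> w"
        using comp by blast
      then show ?thesis
        by (rule order_trans[OF Sup_upper[OF principal_downsets(3)[OF lin i]]])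
    qed (use jw in simp)
    then have "{j \<in> JIc. j \<le> w} \<in> downsets JIc r"
      using sub unfolding downsets_def by blast
    then show "w \<in> downset_chain r"
      using spatial[of w] unfolding downset_chain_def by force
  next
    fix j :: 'a assume j: "j \<in> JIc"
    let ?D = "{k. (k, j) \<in> r \<and> k \<noteq> j}" and ?E = "{k. (k, j) \<in> r}"
    note E = principal_downsets(1)[OF lin j] and D = principal_downsets(2)[OF lin j]
    have jE: "j \<in> ?E" by (rule principal_downsets(3)[OF lin j])
    let ?x = "Sup ?D" and ?y = "Sup ?E"
    have "?E = insert j ?D"
      using jE by blast
    then have sup: "sup ?x j = ?y"
      by (simp add: sup_commute)
    have xk: "?x \<le> kappa j"
      by (rule Sup_downset_le_kappa[OF r D j]) simp
    have "\<not> j \<le> ?x"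
      unfolding mem[OF D j] by simp
    then have "?x < ?y"
      unfolding sup[symmetric] by (simp add: less_le_not_le)
    have "i \<le> ?x" if i: "i \<in> JIc" "i \<le> inf ?y (kappa j)" for i
    proof -
      have "i \<in> ?E" and "i \<noteq> j"
        using i mem[OF E i(1)] not_le_kappa[OF csd j] by auto
      then show ?thesis by (intro Sup_upper) simp
    qed
    then have "Sup {i \<in> JIc. i \<le> inf ?y (kappa j)} \<le> ?x"
      by (intro Sup_least) blast
    then have "inf ?y (kappa j) \<le> ?x"
      using spatial[of "inf ?y (kappa j)"] by simp
    then have "inf ?y (kappa j) = ?x"
      using xk \<open>?x < ?y\<close> by (intro antisym le_infI) simp_all
    moreover have "?x \<in> downset_chain r" "?y \<in> downset_chain r"
      using D E unfolding downset_chain_def by blast+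
    ultimately show "\<exists>x\<in>downset_chain r. \<exists>y\<in>downset_chain r.
        x < y \<and> sup x j = y \<and> inf y (kappa j) = x"
      using sup \<open>?x < ?y\<close> by (intro bexI[of _ ?x] bexI[of _ ?y]) auto
  }
qed

section \<open>The bijection\<close>

theorem theorem1p4:
  assumes "weakly_atomic TYPE('a::complete_lattice)"
    and "completely_semidistributive TYPE('a)"
    and "extremal_lattice TYPE('a)"
  shows "acyclic (labelling_quiver :: 'a rel) \<and>
    partial_order_on JIc (quiver_order :: 'a rel) \<and>
    bij_betw (\<lambda>r. {Sup D | D. D \<in> downsets JIc r})
      {r :: 'a rel. linear_extension JIc quiver_order r}
      {X :: 'a set. extremal_chain X}"
proof (intro conjI)
  obtain X :: "'a set" where "extremal_chain X"
    using assms(3) unfolding extremal_lattice_def by blast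
  then show ac: "acyclic (labelling_quiver :: 'a rel)"
    by (rule acyclic_labelling_quiver[OF assms(2)])
  show "partial_order_on JIc (quiver_order :: 'a rel)"
    using ac by (rule partial_order_quiver_order)
  show "bij_betw (\<lambda>r. {Sup D | D. D \<in> downsets JIc r})
      {r :: 'a rel. linear_extension JIc quiver_order r} {X :: 'a set. extremal_chain X}"
    unfolding downset_chain_def[symmetric]
    using chain_order_downset_chain[OF assms(2)] downset_chain_chain_order[OF assms(1,2)]
      extremal_chain_downset_chain[OF assms(1,2)] linear_extension_chain_order[OF assms(2)]
    by (intro bij_betw_byWitness[where f' = chain_order]) auto
qed

end
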